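(* Let $\{W_j\}_{j\in J}$ be an $f$-basis for $\mathcal{H}$. Then $\{W_j\}_{j\in J}$ is a Hilbert $f$-basis for $\mathcal{H}$ if and only if there exists a constant $B>0$ such that $$\Big\|\sum_{j\in F}g_j\Big\|^2\leq B\sum_{j\in F}\|g_j\|^2$$ for any finite subset $F\subset J$ and arbitrary vectors $g_j\in W_j$.
   Context: $\mathcal{H}$ is a separable Hilbert space and $J$ is a countable (or finite) index set. A sequence $\{W_j\}_{j\in J}$ of closed subspaces of $\mathcal{H}$ is an $f$-basis (fusion Schauder basis) for $\mathcal{H}$ if for every $f\in\mathcal{H}$ there exists a unique sequence $\{g_j\}_{j\in J}$ with $g_j\in W_j$ such that $f=\sum_{j\in J}g_j$, with convergence in norm. Write $\big(\sum_{j\in J}\oplus W_j\big)_{\ell^2}=\{\{g_j\}_{j\in J} : g_j\in W_j,\ \sum_{j\in J}\|g_j\|^2<\infty\}$. An $f$-basis $\{W_j\}_{j\in J}$ is a Hilbert $f$-basis if the series $\sum_{j\in J}g_j$ converges for every $\{g_j\}_{j\in J}\in\big(\sum_{j\in J}\oplus W_j\big)_{\ell^2}$. *)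

theory Defs
  imports "HOL-Analysis.Analysis"
begin

text \<open>
  Hilbert spaces are types of sort \<open>{real_inner, complete_space}\<close>. Complex Hilbert spaces are
  covered: with the inner product \<open>Re \<langle>x, y\<rangle>\<close> a complex Hilbert space is a real one with the same
  norm, hence the same convergence and separability, and its closed complex subspaces are closed
  real subspaces.

  The sums over \<open>J\<close> that define an f-basis are series in the sense of Schauder bases: they converge
  in norm in the order of a given enumeration of \<open>J\<close>, not necessarily unconditionally. The
  enumeration is given by a map \<open>\<nu>\<close> into the natural numbers that is injective on \<open>J\<close>; so \<open>J\<close> is
  finite or countably infinite, and its elements are listed by increasing \<open>\<nu>\<close>. For \<open>J = UNIV\<close> and
  \<open>\<nu> = id\<close> the series are ordinary series over the natural numbers.
\<close>

definition series_sums ::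
    "('i \<Rightarrow> nat) \<Rightarrow> 'i set \<Rightarrow> ('i \<Rightarrow> 'a::real_normed_vector) \<Rightarrow> 'a \<Rightarrow> bool" where
  "series_sums \<nu> J g s \<longleftrightarrow> (\<lambda>n. \<Sum>j | j \<in> J \<and> \<nu> j < n. g j) \<longlonglongrightarrow> s"

lemma series_sums_nat: "series_sums id UNIV g s \<longleftrightarrow> g sums s"
  by (simp add: series_sums_def sums_def lessThan_def)

lemma series_sums_finite:
  assumes "finite J"
  shows "series_sums \<nu> J g s \<longleftrightarrow> s = (\<Sum>j\<in>J. g j)"
proof -
  define m where "m = Suc (Max (insert 0 (\<nu> ` J)))"
  have "\<nu> j < n" if "n \<ge> m" "j \<in> J" for n j
  proof -
    have "\<nu> j \<le> Max (insert 0 (\<nu> ` J))"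
      using assms that(2) by (intro Max_ge) auto
    then show ?thesis using that(1) by (simp add: m_def)
  qed
  then have "{j. j \<in> J \<and> \<nu> j < n} = J" if "n \<ge> m" for n
    using that by auto
  then have "\<forall>\<^sub>F n in sequentially. (\<Sum>j | j \<in> J \<and> \<nu> j < n. g j) = (\<Sum>j\<in>J. g j)"
    unfolding eventually_sequentially by metis
  then have "(\<lambda>n. \<Sum>j | j \<in> J \<and> \<nu> j < n. g j) \<longlonglongrightarrow> (\<Sum>j\<in>J. g j)"
    by (rule tendsto_eventually)
  then show ?thesis
    unfolding series_sums_def using LIMSEQ_unique by blast
qed

text \<open>
  The extensional product \<open>\<Pi>\<^sub>E j\<in>J. W j\<close> fixes the values outside \<open>J\<close>, so that \<open>\<exists>!\<close> expresses
  uniqueness of the family indexed by \<open>J\<close>.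
\<close>

definition f_basis :: "('i \<Rightarrow> nat) \<Rightarrow> 'i set \<Rightarrow> ('i \<Rightarrow> 'a::real_normed_vector set) \<Rightarrow> bool" where
  "f_basis \<nu> J W \<longleftrightarrow>
     (\<forall>j\<in>J. subspace (W j) \<and> closed (W j)) \<and>
     (\<forall>f. \<exists>!g. g \<in> (\<Pi>\<^sub>E j\<in>J. W j) \<and> series_sums \<nu> J g f)"

definition l2_sum :: "'i set \<Rightarrow> ('i \<Rightarrow> 'a::real_normed_vector set) \<Rightarrow> ('i \<Rightarrow> 'a) set" where
  "l2_sum J W = {g \<in> (\<Pi>\<^sub>E j\<in>J. W j). (\<lambda>j. (norm (g j))\<^sup>2) summable_on J}"

definition Hilbert_f_basis ::
    "('i \<Rightarrow> nat) \<Rightarrow> 'i set \<Rightarrow> ('i \<Rightarrow> 'a::real_normed_vector set) \<Rightarrow> bool" where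
  "Hilbert_f_basis \<nu> J W \<longleftrightarrow>
     f_basis \<nu> J W \<and> (\<forall>g\<in>l2_sum J W. \<exists>s. series_sums \<nu> J g s)"

end

theory Submission
  imports Defs
begin

text \<open>
  If the inequality holds, the partial sums of a square-summable family form a Cauchy sequence.
  Conversely, the finitely many \<open>j\<close> with \<open>\<nu> j < N\<close> always satisfy such an inequality by
  Cauchy--Schwarz, so if it fails for every \<open>B\<close> then it fails on every tail \<open>\<nu> j \<ge> N\<close> for every
  \<open>B\<close>. A gliding hump then produces consecutive finite blocks whose vectors sum to norm one while
  the squared norms in the \<open>k\<close>-th block add up to at most \<open>2\<^sup>-\<^sup>k\<close>; their union is a square-summable
  family with a divergent series. Neither step needs the uniform boundedness principle.
\<close>

text \<open>Half-open in the values of \<open>\<nu>\<close>, so that blocks with consecutive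
  endpoints are disjoint and leave no index out.\<close>

definition block :: "('i \<Rightarrow> nat) \<Rightarrow> 'i set \<Rightarrow> nat \<Rightarrow> nat \<Rightarrow> 'i set" where
  "block \<nu> J a b = {j \<in> J. a \<le> \<nu> j \<and> \<nu> j < b}"

lemma finite_initial_segment:
  fixes \<nu> :: "'i \<Rightarrow> nat"
  assumes "inj_on \<nu> J"
  shows "finite {j. j \<in> J \<and> \<nu> j < n}"
proof (rule finite_imageD)
  show "finite (\<nu> ` {j. j \<in> J \<and> \<nu> j < n})"
    by (rule finite_subset[of _ "{..<n}"]) auto
  show "inj_on \<nu> {j. j \<in> J \<and> \<nu> j < n}"
    by (rule inj_on_subset[OF assms]) auto
qed

lemma finite_block: "inj_on \<nu> J \<Longrightarrow> finite (block \<nu> J a b)"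
  by (rule finite_subset[OF _ finite_initial_segment[of \<nu> J b]]) (auto simp: block_def)

lemma sum_initial_segment_diff:
  fixes f :: "'i \<Rightarrow> 'a::ab_group_add"
  assumes "inj_on \<nu> J" "a \<le> b"
  shows "(\<Sum>j | j \<in> J \<and> \<nu> j < b. f j) - (\<Sum>j | j \<in> J \<and> \<nu> j < a. f j) = sum f (block \<nu> J a b)"
proof -
  have "{j. j \<in> J \<and> \<nu> j < b} = {j. j \<in> J \<and> \<nu> j < a} \<union> block \<nu> J a b"
    using assms(2) by (auto simp: block_def)
  moreover have "{j. j \<in> J \<and> \<nu> j < a} \<inter> block \<nu> J a b = {}"
    by (auto simp: block_def)
  ultimately show ?thesis
    by (simp add: sum.union_disjoint finite_initial_segment finite_block assms)
qed

text \<open>On a block, the bound controls an increment of the partial sums of \<open>g\<close> by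
  one of the partial sums of squared norms. The latter are increasing and bounded, hence Cauchy;
  completeness then yields the limit.\<close>

lemma series_converges_if_norm_sum_bound:
  fixes g :: "'i \<Rightarrow> 'a::{real_normed_vector, complete_space}"
    and \<nu> :: "'i \<Rightarrow> nat"
  assumes inj: "inj_on \<nu> J"
    and summable: "(\<lambda>j. (norm (g j))\<^sup>2) summable_on J"
    and "B > 0"
    and bound: "\<And>F. finite F \<Longrightarrow> F \<subseteq> J \<Longrightarrow> (norm (sum g F))\<^sup>2 \<le> B * (\<Sum>j\<in>F. (norm (g j))\<^sup>2)"
  shows "\<exists>s. series_sums \<nu> J g s"
proof -
  define S where "S n = (\<Sum>j | j \<in> J \<and> \<nu> j < n. g j)" for n
  define T where "T n = (\<Sum>j | j \<in> J \<and> \<nu> j < n. (norm (g j))\<^sup>2)" for n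
  have "incseq T"
    unfolding T_def
    by (intro monoI sum_mono2) (auto simp: finite_initial_segment inj)
  moreover have "T n \<le> infsum (\<lambda>j. (norm (g j))\<^sup>2) J" for n
    unfolding T_def
    by (rule finite_sum_le_infsum) (auto simp: finite_initial_segment inj summable)
  ultimately have "Cauchy T"
    using incseq_convergent LIMSEQ_imp_Cauchy by metis
  have step: "(norm (S n - S m))\<^sup>2 \<le> B * (T n - T m)" if "m \<le> n" for m n
    using that bound[OF finite_block[OF inj], of m n]
    by (simp add: S_def T_def sum_initial_segment_diff inj block_def)
  have "Cauchy S"
  proof (rule CauchyI')
    fix e :: real
    assume "e > 0"
    \<comment> \<open>By \<open>step\<close>, an increment of \<open>T\<close> below
      \<open>e\<^sup>2 / B\<close> forces an increment of \<open>S\<close> of norm below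
      \<open>e\<close>.\<close>
    then obtain M where M: "\<And>m n. m \<ge> M \<Longrightarrow> n > m \<Longrightarrow> dist (T m) (T n) < e\<^sup>2 / B"
      using \<open>Cauchy T\<close> \<open>B > 0\<close> unfolding Cauchy_altdef by (meson divide_pos_pos zero_less_power)
    have "dist (S m) (S n) < e" if "m \<ge> M" "n > m" for m n
    proof -
      have "T n - T m < e\<^sup>2 / B"
        using M[OF that] by (simp add: dist_real_def)
      then have "(norm (S n - S m))\<^sup>2 < e\<^sup>2"
        using step[of m n] that \<open>B > 0\<close> by (simp add: field_simps)
      then show ?thesis
        using \<open>e > 0\<close> by (simp add: dist_norm norm_minus_commute power2_less_imp_less)
    qed
    then show "\<exists>M. \<forall>m\<ge>M. \<forall>n>m. dist (S m) (S n) < e"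
      by blast
  qed
  then show ?thesis
    unfolding S_def series_sums_def Cauchy_convergent_iff convergent_def .
qed

text \<open>Triangle inequality, then Cauchy--Schwarz against the constant family 1.\<close>

lemma norm_sum_squared_le_card:
  fixes g :: "'i \<Rightarrow> 'a::real_normed_vector"
  shows "(norm (sum g F))\<^sup>2 \<le> real (card F) * (\<Sum>j\<in>F. (norm (g j))\<^sup>2)"
proof -
  have "(norm (sum g F))\<^sup>2 \<le> (\<Sum>j\<in>F. norm (g j))\<^sup>2"
    by (simp add: norm_sum power_mono)
  also have "\<dots> \<le> real (card F) * (\<Sum>j\<in>F. (norm (g j))\<^sup>2)"
    using sum_squared_le_sum_of_squares[of "\<lambda>j. norm (g j)" F] by (simp add: mult.commute)
  finally show ?thesis .
qed

text \<open>Cut \<open>F\<close> at \<open>N\<close>: the head has a bounded number of elements, so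
  the cardinality bound serves there, and \<open>tail\<close> covers the rest. Read
  contrapositively, an inequality that fails for every constant on \<open>J\<close> still fails for
  every constant beyond any \<open>N\<close>.\<close>

lemma norm_sum_bound_from_tail:
  fixes W :: "'i \<Rightarrow> 'a::real_normed_vector set"
    and \<nu> :: "'i \<Rightarrow> nat"
  assumes inj: "inj_on \<nu> J"
    and "B > 0"
    and tail: "\<And>F g. finite F \<Longrightarrow> F \<subseteq> {j \<in> J. N \<le> \<nu> j} \<Longrightarrow> \<forall>j\<in>F. g j \<in> W j \<Longrightarrow>
      (norm (sum g F))\<^sup>2 \<le> B * (\<Sum>j\<in>F. (norm (g j))\<^sup>2)"
  shows "\<exists>C>0. \<forall>F g. finite F \<and> F \<subseteq> J \<and> (\<forall>j\<in>F. g j \<in> W j) \<longrightarrow>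
    (norm (sum g F))\<^sup>2 \<le> C * (\<Sum>j\<in>F. (norm (g j))\<^sup>2)"
proof -
  define c where "c = real (card {j. j \<in> J \<and> \<nu> j < N})"
  \<comment> \<open>The factor 2 comes from
    \<open>(x + y)\<^sup>2 \<le> 2 * (x\<^sup>2 + y\<^sup>2)\<close>; \<open>c + B\<close> dominates
    the constants of head and tail at once.\<close>
  have "(norm (sum g F))\<^sup>2 \<le> 2 * (c + B) * (\<Sum>j\<in>F. (norm (g j))\<^sup>2)"
    if F: "finite F" "F \<subseteq> J" "\<forall>j\<in>F. g j \<in> W j" for F and g :: "'i \<Rightarrow> 'a"
  proof -
    define P where "P = {j \<in> F. \<nu> j < N}"
    define Q where "Q = {j \<in> F. N \<le> \<nu> j}"
    have PQ: "F = P \<union> Q" "P \<inter> Q = {}" "finite P" "finite Q"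
      using F by (auto simp: P_def Q_def)
    define q where "q X = (\<Sum>j\<in>X. (norm (g j))\<^sup>2)" for X
    have q: "q F = q P + q Q" "q P \<ge> 0" "q Q \<ge> 0"
      using PQ by (simp_all add: q_def sum.union_disjoint sum_nonneg)
    have "real (card P) \<le> c"
      unfolding c_def P_def using F
      by (auto intro!: card_mono finite_initial_segment[OF inj])
    then have "(norm (sum g P))\<^sup>2 \<le> c * q P"
      using norm_sum_squared_le_card[of g P] q(2) mult_right_mono[of "real (card P)" c "q P"]
      unfolding q_def by linarith
    moreover have "(norm (sum g Q))\<^sup>2 \<le> B * q Q"
      unfolding q_def using F by (intro tail) (auto simp: Q_def)
    moreover have "(norm (sum g F))\<^sup>2 \<le> 2 * ((norm (sum g P))\<^sup>2 + (norm (sum g Q))\<^sup>2)"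
    proof -
      have "(norm (sum g F))\<^sup>2 \<le> (norm (sum g P) + norm (sum g Q))\<^sup>2"
        using PQ by (simp add: sum.union_disjoint norm_triangle_ineq power_mono)
      also have "\<dots> \<le> 2 * ((norm (sum g P))\<^sup>2 + (norm (sum g Q))\<^sup>2)"
        using sum_squares_bound[of "norm (sum g P)" "norm (sum g Q)"]
        by (simp add: power2_sum)
      finally show ?thesis .
    qed
    moreover have "0 \<le> c * q Q" "0 \<le> B * q P"
      using q \<open>B > 0\<close> by (simp_all add: c_def)
    ultimately show ?thesis
      using q(1) unfolding q_def[symmetric] by (simp add: algebra_simps)
  qed
  moreover have "2 * (c + B) > 0"
    using \<open>B > 0\<close> by (simp add: c_def add_nonneg_pos)
  ultimately show ?thesis
    by blast
qed

text \<open>Take a finite set beyond \<open>N\<close> on which the inequality fails with constant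
  \<open>inverse \<epsilon>\<close>, and rescale its vectors so that their sum has norm one; the
  failure then says that the squared norms add up to less than \<open>\<epsilon>\<close>.\<close>

lemma hump_exists:
  fixes W :: "'i \<Rightarrow> 'a::real_normed_vector set"
    and \<nu> :: "'i \<Rightarrow> nat"
  assumes inj: "inj_on \<nu> J"
    and sub: "\<forall>j\<in>J. subspace (W j)"
    and unbounded: "\<nexists>B. B > 0 \<and> (\<forall>F g. finite F \<and> F \<subseteq> J \<and> (\<forall>j\<in>F. g j \<in> W j) \<longrightarrow>
      (norm (sum g F))\<^sup>2 \<le> B * (\<Sum>j\<in>F. (norm (g j))\<^sup>2))"
    and "\<epsilon> > 0"
  shows "\<exists>M h. N \<le> M \<and> (\<forall>j\<in>J. h j \<in> W j) \<and> norm (sum h (block \<nu> J N M)) = 1 \<and>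
    (\<Sum>j\<in>block \<nu> J N M. (norm (h j))\<^sup>2) \<le> \<epsilon>"
proof -
  have "\<exists>F g. finite F \<and> F \<subseteq> {j \<in> J. N \<le> \<nu> j} \<and> (\<forall>j\<in>F. g j \<in> W j) \<and>
      \<not> (norm (sum g F))\<^sup>2 \<le> inverse \<epsilon> * (\<Sum>j\<in>F. (norm (g j))\<^sup>2)"
  proof (rule ccontr)
    assume "\<not> ?thesis"
    then have tail: "(norm (sum g F))\<^sup>2 \<le> inverse \<epsilon> * (\<Sum>j\<in>F. (norm (g j))\<^sup>2)"
      if "finite F" "F \<subseteq> {j \<in> J. N \<le> \<nu> j}" "\<forall>j\<in>F. g j \<in> W j" for F g
      using that by blast
    show False
      using norm_sum_bound_from_tail[OF inj _ tail] unbounded \<open>\<epsilon> > 0\<close> by simp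
  qed
  then obtain F g where F: "finite F" "F \<subseteq> {j \<in> J. N \<le> \<nu> j}" "\<forall>j\<in>F. g j \<in> W j"
    and large: "(norm (sum g F))\<^sup>2 > inverse \<epsilon> * (\<Sum>j\<in>F. (norm (g j))\<^sup>2)"
    unfolding not_le by blast
  define r where "r = norm (sum g F)"
  have "inverse \<epsilon> * (\<Sum>j\<in>F. (norm (g j))\<^sup>2) \<ge> 0"
    using \<open>\<epsilon> > 0\<close> by (simp add: sum_nonneg)
  then have "r > 0"
    using large unfolding r_def by (metis norm_ge_zero less_le order.strict_trans1 power_zero_numeral)
  \<comment> \<open>The block may contain indices outside \<open>F\<close>; the value 0 there lies
    in every subspace and changes neither sum.\<close>
  define h where "h j = (if j \<in> F then inverse r *\<^sub>R g j else 0)" for j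
  \<comment> \<open>\<open>Suc\<close> because the right end of a block is excluded; inserting
    \<open>N\<close> gives \<open>N \<le> M\<close>.\<close>
  define M where "M = Suc (Max (insert N (\<nu> ` F)))"
  have "N \<le> M"
    unfolding M_def using F(1) by (simp add: le_SucI)
  have "F \<subseteq> block \<nu> J N M"
    using F by (auto simp: block_def M_def less_Suc_eq_le)
  then have sum_h: "sum h (block \<nu> J N M) = sum h F"
    and sum_norm_h: "(\<Sum>j\<in>block \<nu> J N M. (norm (h j))\<^sup>2) = (\<Sum>j\<in>F. (norm (h j))\<^sup>2)"
    by (intro sum.mono_neutral_right; simp add: finite_block inj h_def)+
  have "sum h F = inverse r *\<^sub>R sum g F"
    by (simp add: h_def scaleR_right.sum)
  then have "norm (sum h (block \<nu> J N M)) = 1"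
    using sum_h \<open>r > 0\<close> by (simp add: r_def)
  moreover have "(\<Sum>j\<in>block \<nu> J N M. (norm (h j))\<^sup>2) \<le> \<epsilon>"
  proof -
    have "(\<Sum>j\<in>block \<nu> J N M. (norm (h j))\<^sup>2) = (\<Sum>j\<in>F. (norm (g j))\<^sup>2) / r\<^sup>2"
      using \<open>r > 0\<close> unfolding sum_norm_h
      by (simp add: h_def sum_divide_distrib field_simps)
    also have "\<dots> \<le> \<epsilon>"
      using large \<open>r > 0\<close> \<open>\<epsilon> > 0\<close> by (simp add: r_def[symmetric] field_simps)
    finally show ?thesis .
  qed
  moreover have "\<forall>j\<in>J. h j \<in> W j"
    using F sub by (auto simp: h_def subspace_scale subspace_0)
  ultimately show ?thesis
    using \<open>N \<le> M\<close> by blast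
qed

lemma norm_sum_bound_if_series_converge:
  fixes W :: "'i \<Rightarrow> 'a::real_normed_vector set"
    and \<nu> :: "'i \<Rightarrow> nat"
  assumes inj: "inj_on \<nu> J"
    and sub: "\<forall>j\<in>J. subspace (W j)"
    and conv: "\<forall>g\<in>l2_sum J W. \<exists>s. series_sums \<nu> J g s"
  shows "\<exists>B>0. \<forall>F g. finite F \<and> F \<subseteq> J \<and> (\<forall>j\<in>F. g j \<in> W j) \<longrightarrow>
    (norm (sum g F))\<^sup>2 \<le> B * (\<Sum>j\<in>F. (norm (g j))\<^sup>2)"
proof (rule ccontr)
  assume "\<not> ?thesis"
  then have "\<exists>M h. N \<le> M \<and> (\<forall>j\<in>J. h j \<in> W j) \<and> norm (sum h (block \<nu> J N M)) = 1 \<and>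
      (\<Sum>j\<in>block \<nu> J N M. (norm (h j))\<^sup>2) \<le> (1 / 2) ^ k" for N k
    using hump_exists[OF inj sub, of "(1 / 2) ^ k" N] by simp
  then obtain M h where le_M: "\<And>N k. N \<le> M N k" and h_mem: "\<And>N k j. j \<in> J \<Longrightarrow> h N k j \<in> W j"
    and h_norm: "\<And>N k. norm (sum (h N k) (block \<nu> J N (M N k))) = 1"
    and h_small: "\<And>N k. (\<Sum>j\<in>block \<nu> J N (M N k). (norm (h N k j))\<^sup>2) \<le> (1 / 2) ^ k"
    by metis
  \<comment> \<open>Each hump starts where the previous one ends.\<close>
  define N where "N = rec_nat 0 (\<lambda>k n. M n k)"
  have N: "N 0 = 0" "N (Suc k) = M (N k) k" for k
    by (simp_all add: N_def)
  define I where "I k = block \<nu> J (N k) (N (Suc k))" for k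
  have "N k < N (Suc k)" for k
  proof -
    \<comment> \<open>An empty block would have sum 0, not a sum of norm one.\<close>
    have "block \<nu> J (N k) (M (N k) k) \<noteq> {}"
      using h_norm[of "N k" k] by force
    then show ?thesis
      by (auto simp: N block_def)
  qed
  then have N_mono: "strict_mono N"
    by (rule strict_mono_Suc_iff[THEN iffD2, rule_format])
  \<comment> \<open>\<open>K j\<close> is the number of the block that contains \<open>j\<close>; it
    selects the hump from which \<open>g\<close> takes its value at \<open>j\<close>. Restricting
    \<open>g\<close> to \<open>J\<close> makes it extensional, as \<open>l2_sum\<close>
    demands.\<close>
  define K where "K j = (LEAST k. \<nu> j < N (Suc k))" for j
  define g where "g = (\<lambda>j\<in>J. h (N (K j)) (K j) j)"
  have g_eq: "g j = h (N k) k j" if "j \<in> I k" for j k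
  proof -
    have j: "j \<in> J" "N k \<le> \<nu> j" "\<nu> j < N (Suc k)"
      using that by (auto simp: I_def block_def)
    have "K j = k"
      unfolding K_def
    proof (rule Least_equality)
      fix y
      assume "\<nu> j < N (Suc y)"
      then have "N k < N (Suc y)"
        using j by simp
      then show "k \<le> y"
        using N_mono by (simp add: strict_mono_less)
    qed (rule j)
    then show ?thesis
      using j by (simp add: g_def)
  qed
  have small: "(\<Sum>j\<in>I k. (norm (g j))\<^sup>2) \<le> (1 / 2) ^ k" for k
    using h_small[of "N k" k] by (simp add: g_eq I_def[symmetric] N(2)[symmetric])
  have unit: "norm (sum g (I k)) = 1" for k
    using h_norm[of "N k" k] by (simp add: g_eq I_def[symmetric] N(2)[symmetric])
  \<comment> \<open>The segment below \<open>N n\<close> is the union of the first \<open>n\<close>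
    blocks, so the bounds in \<open>small\<close> add up to a geometric sum.\<close>
  have initial: "(\<Sum>j | j \<in> J \<and> \<nu> j < N n. (norm (g j))\<^sup>2) \<le> (\<Sum>k<n. (1 / 2) ^ k)" for n
  proof (induction n)
    case 0
    then show ?case by (simp add: N)
  next
    case (Suc n)
    have "N n \<le> N (Suc n)"
      using N_mono by (simp add: strict_mono_less_eq)
    then show ?case
      using Suc small[of n] sum_initial_segment_diff[OF inj, of "N n" "N (Suc n)" "\<lambda>j. (norm (g j))\<^sup>2"]
      by (simp add: I_def)
  qed
  have "(\<lambda>j. (norm (g j))\<^sup>2) summable_on J"
  proof (rule nonneg_bdd_above_summable_on)
    show "bdd_above (sum (\<lambda>j. (norm (g j))\<^sup>2) ` {F. F \<subseteq> J \<and> finite F})"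
    proof (rule bdd_aboveI2)
      fix F
      assume "F \<in> {F. F \<subseteq> J \<and> finite F}"
      then have F: "F \<subseteq> J" "finite F" by auto
      \<comment> \<open>Since \<open>n \<le> N n\<close>, the set \<open>F\<close> lies in the
        segment below \<open>N n\<close>, and the full geometric series bounds its sum independently
        of \<open>F\<close>.\<close>
      define n where "n = Suc (Max (insert 0 (\<nu> ` F)))"
      have "\<nu> j < N n" if "j \<in> F" for j
      proof -
        have "\<nu> j < n"
          using that F by (simp add: n_def less_Suc_eq_le)
        also have "n \<le> N n"
          by (rule strict_mono_imp_increasing[OF N_mono])
        finally show ?thesis .
      qed
      then have "(\<Sum>j\<in>F. (norm (g j))\<^sup>2) \<le> (\<Sum>j | j \<in> J \<and> \<nu> j < N n. (norm (g j))\<^sup>2)"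
        using F by (intro sum_mono2 finite_initial_segment inj) auto
      also have "\<dots> \<le> (\<Sum>k<n. (1 / 2) ^ k)"
        by (rule initial)
      also have "\<dots> \<le> (\<Sum>k. (1 / 2) ^ k)"
        by (rule sum_le_suminf) auto
      finally show "(\<Sum>j\<in>F. (norm (g j))\<^sup>2) \<le> (\<Sum>k. (1 / 2) ^ k)" .
    qed
  qed simp
  then have "g \<in> l2_sum J W"
    by (auto simp: l2_sum_def g_def h_mem)
  then obtain s where "series_sums \<nu> J g s"
    using conv by blast
  define S where "S n = (\<Sum>j | j \<in> J \<and> \<nu> j < n. g j)" for n
  have "S \<longlonglongrightarrow> s"
    using \<open>series_sums \<nu> J g s\<close> unfolding series_sums_def S_def .
  then have lim: "(\<lambda>k. S (N k)) \<longlonglongrightarrow> s"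
    using LIMSEQ_subseq_LIMSEQ[OF _ N_mono] by (simp add: o_def)
  \<comment> \<open>Convergence would make the block sums tend to 0, yet each has norm one.\<close>
  have "(\<lambda>k. norm (S (N (Suc k)) - S (N k))) \<longlonglongrightarrow> norm (s - s)"
    by (intro tendsto_intros lim LIMSEQ_Suc[OF lim])
  moreover have "norm (S (N (Suc k)) - S (N k)) = 1" for k
  proof -
    have "N k \<le> N (Suc k)"
      using N_mono by (simp add: strict_mono_less_eq)
    then show ?thesis
      using unit[of k] by (simp add: S_def sum_initial_segment_diff[OF inj] I_def)
  qed
  ultimately show False
    by (simp add: LIMSEQ_const_iff)
qed

theorem theorem2p13:
  fixes W :: "'i \<Rightarrow> 'a::{real_inner, complete_space} set"
    and J :: "'i set"
    and \<nu> :: "'i \<Rightarrow> nat"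
  assumes "separable_space (euclidean :: 'a topology)"
    and "inj_on \<nu> J"
    and "f_basis \<nu> J W"
  shows "Hilbert_f_basis \<nu> J W \<longleftrightarrow>
    (\<exists>B>0. \<forall>F g. finite F \<and> F \<subseteq> J \<and> (\<forall>j\<in>F. g j \<in> W j) \<longrightarrow>
       (norm (\<Sum>j\<in>F. g j))\<^sup>2 \<le> B * (\<Sum>j\<in>F. (norm (g j))\<^sup>2))"
    (is "_ \<longleftrightarrow> ?bounded")
proof
  assume "Hilbert_f_basis \<nu> J W"
  then show ?bounded
    using norm_sum_bound_if_series_converge[OF assms(2), of W]
    by (simp add: Hilbert_f_basis_def f_basis_def)
next
  assume ?bounded
  then obtain B where "B > 0" and B: "\<forall>F g. finite F \<and> F \<subseteq> J \<and> (\<forall>j\<in>F. g j \<in> W j) \<longrightarrow>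
      (norm (sum g F))\<^sup>2 \<le> B * (\<Sum>j\<in>F. (norm (g j))\<^sup>2)"
    by (elim exE conjE)
  have "\<exists>s. series_sums \<nu> J g s" if "g \<in> l2_sum J W" for g
  proof (rule series_converges_if_norm_sum_bound[OF assms(2) _ \<open>B > 0\<close>])
    show "(\<lambda>j. (norm (g j))\<^sup>2) summable_on J"
      using that by (simp add: l2_sum_def)
    show "(norm (sum g F))\<^sup>2 \<le> B * (\<Sum>j\<in>F. (norm (g j))\<^sup>2)" if "finite F" "F \<subseteq> J" for F
      using that \<open>g \<in> l2_sum J W\<close> by (intro B[rule_format]) (auto simp: l2_sum_def)
  qed
  then show "Hilbert_f_basis \<nu> J W"
    using assms(3) by (simp add: Hilbert_f_basis_def)
qed

end
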